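(* Let $\lambda$ be an infinite cardinal number. Any two $P$-spaces which have $\lambda$-thin labelings are homeomorphic.
   Context: A $P$-space is a completely regular $T_1$-space in which every countable intersection of open sets is open. A partition of a space is a cover by pairwise disjoint nonempty open (hence clopen) sets. A $P$-matrix for a $P$-space $X$ is a family $\mathfrak{M}_X=\{\mathcal{P}_\alpha:\alpha<\omega_1\}$ such that: (1) each $\mathcal{P}_\alpha$ is a partition of $X$; (2) if $\beta<\alpha$, then $\mathcal{P}_\alpha$ refines $\mathcal{P}_\beta$; (3) $\bigcup\mathfrak{M}_X=\bigcup_{\alpha<\omega_1}\mathcal{P}_\alpha$ is a base for $X$; (4) if $\alpha$ is an infinite limit ordinal and $U\in\mathcal{P}_\alpha$, then $U=\bigcap\{V\in\mathcal{P}_\beta:\beta<\alpha,\ U\subseteq V\}$. A labeling is a surjection $E\colon\bigcup\mathfrak{M}_X\to X$ such that $E(V)\in V$ for all $V\in\bigcup\mathfrak{M}_X$, and whenever $U,V\in\bigcup\mathfrak{M}_X$, $U\subseteq V$ and $E(V)\in U$, then $E(U)=E(V)$. For an infinite cardinal $\lambda$, the space $X$ has a $\lambda$-thin labeling if there exist a $P$-matrix $\{\mathcal{P}_\alpha:\alpha<\omega_1\}$ for $X$ and a labeling $E$ on it such that: each $\mathcal{P}_\alpha$ has cardinality $\lambda$, and for $\beta<\alpha$ every $V\in\mathcal{P}_\beta$ contains $\lambda$ many elements of $\mathcal{P}_\alpha$; and, for every $\alpha<\omega_1$ and every nonempty chain (with respect to inclusion) $\mathcal{L}\subseteq\bigcup\{\mathcal{P}_\beta:\beta<\alpha\}$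 with $\bigcap\mathcal{L}\neq\emptyset$, there is $V\in\mathcal{L}$ with $E(V)\in\bigcap\mathcal{L}$. *)

theory Defs
  imports "HOL-Analysis.Analysis" "HOL-Library.Countable_Set_Type"
begin

unbundle cardinal_syntax

definition P_space :: "'a topology \<Rightarrow> bool" where
  "P_space X \<longleftrightarrow> completely_regular_space X \<and> t1_space X \<and>
     (\<forall>\<U>. countable \<U> \<and> \<U> \<noteq> {} \<and> (\<forall>U\<in>\<U>. openin X U) \<longrightarrow> openin X (\<Inter>\<U>))"

definition open_partition :: "'a topology \<Rightarrow> 'a set set \<Rightarrow> bool" where
  "open_partition X \<P> \<longleftrightarrow> partition_on (topspace X) \<P> \<and> (\<forall>U\<in>\<P>. openin X U)"

definition base_of :: "'a topology \<Rightarrow> 'a set set \<Rightarrow> bool" where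
  "base_of X \<B> \<longleftrightarrow> openin X = arbitrary union_of (\<lambda>U. U \<in> \<B>)"

(* The ordinal \<omega>_1, realised as the initial well-order (reflexive, as usual for library
   orders) of cardinality \<aleph>_1.  The countable ordinals are the elements of Field omega1,
   and \<beta> < \<alpha> < \<omega>_1 is written \<beta> \<in> underS omega1 \<alpha>. *)
definition omega1 :: "nat set rel" where
  "omega1 = cardSuc natLeq"

lemma Card_order_omega1: "Card_order omega1"
  unfolding omega1_def by (rule cardSuc_Card_order[OF natLeq_Card_order])

lemma uncountable_Field_omega1: "uncountable (Field omega1)"
proof
  assume "countable (Field omega1)"
  then have "|Field omega1| \<le>o natLeq"
    using countable_card_le_natLeq by blast
  then have "omega1 \<le>o natLeq"
    using Card_order_omega1 card_of_Field_ordIso ordIso_ordLeq_trans ordIso_symmetric by blast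
  moreover have "natLeq <o omega1"
    unfolding omega1_def by (rule cardSuc_greater[OF natLeq_Card_order])
  ultimately show False
    using not_ordLess_ordLeq by blast
qed

lemma countable_underS_omega1:
  assumes "\<alpha> \<in> Field omega1"
  shows "countable (underS omega1 \<alpha>)"
proof -
  have "|underS omega1 \<alpha>| <o omega1"
    using card_of_underS[OF Card_order_omega1 assms] .
  then have "|underS omega1 \<alpha>| \<le>o natLeq"
    unfolding omega1_def
    using cardSuc_ordLeq_ordLess[OF natLeq_Card_order card_of_Card_order] by blast
  then show ?thesis
    using countable_card_le_natLeq by blast
qed

(* In a well-order: neither the least element (zero) nor a successor; such ordinals are infinite. *)
definition limit_ordinal :: "nat set \<Rightarrow> bool" where
  "limit_ordinal \<alpha> \<longleftrightarrow> \<alpha> \<in> Field omega1 \<and> underS omega1 \<alpha> \<noteq> {} \<and>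
     (\<forall>\<beta>\<in>underS omega1 \<alpha>. \<exists>\<gamma>\<in>underS omega1 \<alpha>. \<beta> \<in> underS omega1 \<gamma>)"

definition matrix_union :: "(nat set \<Rightarrow> 'a set set) \<Rightarrow> 'a set set" where
  "matrix_union \<P> = (\<Union>\<alpha>\<in>Field omega1. \<P> \<alpha>)"

definition P_matrix :: "'a topology \<Rightarrow> (nat set \<Rightarrow> 'a set set) \<Rightarrow> bool" where
  "P_matrix X \<P> \<longleftrightarrow>
     (\<forall>\<alpha>\<in>Field omega1. open_partition X (\<P> \<alpha>)) \<and>
     (\<forall>\<alpha>\<in>Field omega1. \<forall>\<beta>\<in>underS omega1 \<alpha>. refines (topspace X) (\<P> \<alpha>) (\<P> \<beta>)) \<and>
     base_of X (matrix_union \<P>) \<and>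
     (\<forall>\<alpha>. limit_ordinal \<alpha> \<longrightarrow>
        (\<forall>U\<in>\<P> \<alpha>. U = \<Inter>{V. \<exists>\<beta>\<in>underS omega1 \<alpha>. V \<in> \<P> \<beta> \<and> U \<subseteq> V}))"

definition labeling :: "'a topology \<Rightarrow> (nat set \<Rightarrow> 'a set set) \<Rightarrow> ('a set \<Rightarrow> 'a) \<Rightarrow> bool" where
  "labeling X \<P> E \<longleftrightarrow>
     E ` matrix_union \<P> = topspace X \<and>
     (\<forall>V\<in>matrix_union \<P>. E V \<in> V) \<and>
     (\<forall>U\<in>matrix_union \<P>. \<forall>V\<in>matrix_union \<P>. U \<subseteq> V \<and> E V \<in> U \<longrightarrow> E U = E V)"

(* A cardinal number is represented by a cardinal order l, so |A| =o l says that A has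
   cardinality l. *)
definition thin_labeling ::
    "'c rel \<Rightarrow> 'a topology \<Rightarrow> (nat set \<Rightarrow> 'a set set) \<Rightarrow> ('a set \<Rightarrow> 'a) \<Rightarrow> bool" where
  "thin_labeling l X \<P> E \<longleftrightarrow>
     P_matrix X \<P> \<and> labeling X \<P> E \<and>
     (\<forall>\<alpha>\<in>Field omega1. |\<P> \<alpha>| =o l) \<and>
     (\<forall>\<alpha>\<in>Field omega1. \<forall>\<beta>\<in>underS omega1 \<alpha>. \<forall>V\<in>\<P> \<beta>. |{U \<in> \<P> \<alpha>. U \<subseteq> V}| =o l) \<and>
     (\<forall>\<alpha>\<in>Field omega1. \<forall>\<L>. \<L> \<subseteq> (\<Union>\<beta>\<in>underS omega1 \<alpha>. \<P> \<beta>) \<and> \<L> \<noteq> {} \<and>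
        chain_subset \<L> \<and> \<Inter>\<L> \<noteq> {} \<longrightarrow> (\<exists>V\<in>\<L>. E V \<in> \<Inter>\<L>))"

definition has_thin_labeling :: "'c rel \<Rightarrow> 'a topology \<Rightarrow> bool" where
  "has_thin_labeling l X \<longleftrightarrow> (\<exists>\<P> E. thin_labeling l X \<P> E)"

end

theory Submission
  imports Defs
begin

text \<open>
  A point is coded by recording, at each countable ordinal that is not a limit, which of the
  \<open>\<lambda>\<close> children of the current cell it lies in, where the child containing the label of the
  current cell always gets one fixed code. Limit levels carry no information by condition (4) of a
  \<open>P\<close>-matrix. Thinness says that below every limit ordinal the code is eventually trivial, and
  surjectivity of the labeling says the same for the whole code; so codes have finite support.
  Conversely, passing from a cell to its label extends a code trivially, so that all codes of finite
  support occur. Hence both spaces are homeomorphic to the same space of finitely supported codes.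
\<close>

section \<open>The strict order on the countable ordinals\<close>

lemma wo_rel_omega1: "wo_rel omega1"
  using Card_order_omega1 by (simp add: card_order_on_well_order_on wo_rel_def)

lemma underS_omega1_Field: "\<beta> \<in> underS omega1 \<alpha> \<Longrightarrow> \<beta> \<in> Field omega1"
  by (auto simp: underS_def Field_def)

lemma underS_omega1_trans:
  "\<gamma> \<in> underS omega1 \<beta> \<Longrightarrow> \<beta> \<in> underS omega1 \<alpha> \<Longrightarrow> \<gamma> \<in> underS omega1 \<alpha>"
  using wo_rel.TRANS[OF wo_rel_omega1] wo_rel.ANTISYM[OF wo_rel_omega1]
  unfolding underS_def trans_def antisym_def by blast

lemma underS_omega1_irrefl: "\<alpha> \<notin> underS omega1 \<alpha>"
  by (simp add: underS_def)

lemma underS_omega1_total: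
  assumes "\<alpha> \<in> Field omega1" "\<beta> \<in> Field omega1"
  shows "\<alpha> = \<beta> \<or> \<alpha> \<in> underS omega1 \<beta> \<or> \<beta> \<in> underS omega1 \<alpha>"
  using wo_rel.TOTALS[OF wo_rel_omega1] assms unfolding underS_def by blast

text \<open>Here \<open>\<alpha>\<close> ranges over the whole type: outside
  \<open>Field omega1\<close> the set \<open>underS omega1 \<alpha>\<close> is empty. Statements
  proved this way therefore carry membership in the field as a premise.\<close>

lemma omega1_induct:
  assumes "\<And>\<alpha>. (\<And>\<beta>. \<beta> \<in> underS omega1 \<alpha> \<Longrightarrow> P \<beta>) \<Longrightarrow> P \<alpha>"
  shows "P \<alpha>"
  by (rule wo_rel.well_order_induct[OF wo_rel_omega1]) (auto intro: assms simp: underS_def)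

lemma ex_omega1_least: "\<exists>\<alpha>\<in>Field omega1. underS omega1 \<alpha> = {}"
proof -
  have "\<alpha> \<in> Field omega1 \<longrightarrow> ?thesis" for \<alpha>
    by (induction \<alpha> rule: omega1_induct) (use underS_omega1_Field in blast)
  moreover have "Field omega1 \<noteq> {}"
    using uncountable_Field_omega1 by auto
  ultimately show ?thesis by blast
qed

lemma finite_omega1_has_max:
  assumes "finite F" "F \<noteq> {}" "F \<subseteq> Field omega1"
  shows "\<exists>\<alpha>\<in>F. \<forall>\<beta>\<in>F. \<beta> = \<alpha> \<or> \<beta> \<in> underS omega1 \<alpha>"
  using assms
proof (induction F rule: finite_ne_induct)
  case (insert \<gamma> F)
  then obtain \<alpha> where \<alpha>: "\<alpha> \<in> F" "\<forall>\<beta>\<in>F. \<beta> = \<alpha> \<or> \<beta> \<in> underS omega1 \<alpha>"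
    by auto
  consider "\<gamma> = \<alpha> \<or> \<gamma> \<in> underS omega1 \<alpha>" | "\<alpha> \<in> underS omega1 \<gamma>"
    using underS_omega1_total[of \<gamma> \<alpha>] insert.prems \<alpha>(1) by auto
  then show ?case
  proof cases
    case 1
    then show ?thesis using \<alpha> by (intro bexI[of _ \<alpha>]) auto
  next
    case 2
    then show ?thesis
      using \<alpha>(2) underS_omega1_trans[OF _ 2] by (intro bexI[of _ \<gamma>]) auto
  qed
qed simp

text \<open>The two cases are zero and successor; \<open>\<delta>\<close> is the immediate
  predecessor. Failure of the limit condition gives a \<open>\<delta>\<close> with nothing strictly
  between it and \<open>\<alpha>\<close>, and totality makes it the largest element below
  \<open>\<alpha>\<close>.\<close>

lemma nonlimit_cases:
  assumes "\<alpha> \<in> Field omega1" "\<not> limit_ordinal \<alpha>"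
  obtains "underS omega1 \<alpha> = {}"
  | \<delta> where "\<delta> \<in> underS omega1 \<alpha>" "\<And>\<beta>. \<beta> \<in> underS omega1 \<alpha> \<Longrightarrow> \<beta> = \<delta> \<or> \<beta> \<in> underS omega1 \<delta>"
proof (cases "underS omega1 \<alpha> = {}")
  case False
  then obtain \<delta> where "\<delta> \<in> underS omega1 \<alpha>" "\<forall>\<gamma>\<in>underS omega1 \<alpha>. \<delta> \<notin> underS omega1 \<gamma>"
    using assms unfolding limit_ordinal_def by blast
  then show ?thesis
    using that(2) underS_omega1_total[OF underS_omega1_Field underS_omega1_Field] by blast
qed (use that in blast)

text \<open>At most one element satisfies \<open>Q\<close>. Any bijection can be followed by the
  transposition that moves the value at this element to \<open>z\<close>.\<close>

lemma ex_bij_betw_prescribed: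
  fixes l :: "'c rel"
  assumes "|A| =o l" "Card_order l" "z \<in> Field l" "\<And>a b. \<lbrakk>a \<in> A; b \<in> A; Q a; Q b\<rbrakk> \<Longrightarrow> a = b"
  shows "\<exists>g. bij_betw g A (Field l) \<and> (\<forall>a\<in>A. Q a \<longrightarrow> g a = z)"
proof -
  have "|A| =o |Field l|"
    using assms(1,2) card_of_Field_ordIso ordIso_symmetric ordIso_transitive by blast
  then obtain g where g: "bij_betw g A (Field l)"
    using card_of_ordIso by blast
  show ?thesis
  proof (cases "\<exists>a\<in>A. Q a")
    case True
    then obtain a where a: "a \<in> A" "Q a" by blast
    then have "bij_betw (Transposition.transpose (g a) z) (Field l) (Field l)"
      using g assms(3) by (intro permutes_imp_bij permutes_swap_id) (auto dest: bij_betwE)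
    then have "bij_betw (Transposition.transpose (g a) z \<circ> g) A (Field l)"
      using g bij_betw_trans by blast
    moreover have "\<forall>b\<in>A. Q b \<longrightarrow> (Transposition.transpose (g a) z \<circ> g) b = z"
    proof (intro ballI impI)
      fix b assume "b \<in> A" "Q b"
      then have "b = a" using assms(4) a by blast
      then show "(Transposition.transpose (g a) z \<circ> g) b = z" by simp
    qed
    ultimately show ?thesis by blast
  qed (use g in blast)
qed

text \<open>The common range of the code maps of both spaces: it depends on \<open>l\<close> and
  \<open>z\<close> alone. Fixing the value \<open>z\<close> wherever no information is stored lets
  equality of codes be equality of functions.\<close>

definition finite_codes :: "'c rel \<Rightarrow> 'c \<Rightarrow> (nat set \<Rightarrow> 'c) set" where
  "finite_codes l z = {c. (\<forall>\<alpha>. c \<alpha> \<in> Field l) \<and> finite {\<alpha>. c \<alpha> \<noteq> z} \<and>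
     (\<forall>\<alpha>. c \<alpha> \<noteq> z \<longrightarrow> \<alpha> \<in> Field omega1 \<and> \<not> limit_ordinal \<alpha>)}"

section \<open>Cells, branches and codes in a space with a thin labeling\<close>

locale thinly_labeled =
  fixes l :: "'c rel" and z :: 'c and X :: "'a topology"
    and \<P> :: "nat set \<Rightarrow> 'a set set" and E :: "'a set \<Rightarrow> 'a"
  assumes Card_order: "Card_order l" and z: "z \<in> Field l"
    and t1: "t1_space X" and thin: "thin_labeling l X \<P> E"
begin

text \<open>The union serves as a description operator: for a countable ordinal and a point of the
  space, exactly one member of the partition is collected.\<close>

definition cell :: "nat set \<Rightarrow> 'a \<Rightarrow> 'a set" where
  "cell \<alpha> x = \<Union>{U \<in> \<P> \<alpha>. x \<in> U}"

text \<open>Intersecting with \<open>topspace X\<close> makes the branch at the least ordinal the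
  whole space instead of the universe of the type.\<close>

definition branch :: "nat set \<Rightarrow> 'a \<Rightarrow> 'a set" where
  "branch \<alpha> x = topspace X \<inter> (\<Inter>\<beta>\<in>underS omega1 \<alpha>. cell \<beta> x)"

definition children :: "nat set \<Rightarrow> 'a set \<Rightarrow> 'a set set" where
  "children \<alpha> B = {U \<in> \<P> \<alpha>. U \<subseteq> B}"

text \<open>The choice depends on the set \<open>B\<close> and not on a point, so points with a
  common branch are coded by the same bijection.\<close>

definition numbering :: "nat set \<Rightarrow> 'a set \<Rightarrow> 'a set \<Rightarrow> 'c" where
  "numbering \<alpha> B = (SOME g. bij_betw g (children \<alpha> B) (Field l) \<and>
     (\<forall>U\<in>children \<alpha> B. E B \<in> U \<longrightarrow> g U = z))"

definition code :: "'a \<Rightarrow> nat set \<Rightarrow> 'c" where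
  "code x \<alpha> = (if \<alpha> \<in> Field omega1 \<and> \<not> limit_ordinal \<alpha>
     then numbering \<alpha> (branch \<alpha> x) (cell \<alpha> x) else z)"

lemma matrix: "P_matrix X \<P>" and labeling: "labeling X \<P> E"
  using thin by (auto simp: thin_labeling_def)

lemma partition: "\<alpha> \<in> Field omega1 \<Longrightarrow> partition_on (topspace X) (\<P> \<alpha>)"
  and openin_cells: "\<alpha> \<in> Field omega1 \<Longrightarrow> U \<in> \<P> \<alpha> \<Longrightarrow> openin X U"
proof -
  have "\<forall>\<alpha>\<in>Field omega1. open_partition X (\<P> \<alpha>)"
    using matrix unfolding P_matrix_def by (elim conjE)
  then show "\<alpha> \<in> Field omega1 \<Longrightarrow> partition_on (topspace X) (\<P> \<alpha>)"
    and "\<alpha> \<in> Field omega1 \<Longrightarrow> U \<in> \<P> \<alpha> \<Longrightarrow> openin X U"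
    by (auto simp: open_partition_def)
qed

lemma label_in: "\<alpha> \<in> Field omega1 \<Longrightarrow> U \<in> \<P> \<alpha> \<Longrightarrow> E U \<in> U"
  using labeling unfolding labeling_def matrix_union_def by blast

lemma label_eq:
  assumes "\<alpha> \<in> Field omega1" "U \<in> \<P> \<alpha>" "\<beta> \<in> Field omega1" "V \<in> \<P> \<beta>"
    and "U \<subseteq> V" "E V \<in> U"
  shows "E U = E V"
proof -
  have UV: "U \<in> matrix_union \<P>" "V \<in> matrix_union \<P>"
    using assms(1-4) by (auto simp: matrix_union_def)
  have "\<forall>U\<in>matrix_union \<P>. \<forall>V\<in>matrix_union \<P>. U \<subseteq> V \<and> E V \<in> U \<longrightarrow> E U = E V"
    using labeling unfolding labeling_def by (elim conjE)
  from bspec[OF bspec[OF this UV(1)] UV(2)] show ?thesis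
    using assms(5,6) by simp
qed

lemma ex_label:
  assumes "x \<in> topspace X"
  shows "\<exists>\<alpha>\<in>Field omega1. \<exists>U\<in>\<P> \<alpha>. x = E U"
proof -
  have "E ` matrix_union \<P> = topspace X"
    using labeling unfolding labeling_def by (elim conjE)
  then have "x \<in> E ` matrix_union \<P>"
    using assms by simp
  then show ?thesis by (auto simp: matrix_union_def)
qed

lemma cell_unique:
  assumes "\<alpha> \<in> Field omega1" "U \<in> \<P> \<alpha>" "x \<in> U"
  shows "cell \<alpha> x = U"
proof -
  have "{U \<in> \<P> \<alpha>. x \<in> U} = {U}"
    using partition[OF assms(1)] assms(2,3) unfolding partition_on_def disjoint_def by blast
  then show ?thesis by (simp add: cell_def)
qed

lemma cell:
  assumes "\<alpha> \<in> Field omega1" "x \<in> topspace X"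
  shows cell_in: "cell \<alpha> x \<in> \<P> \<alpha>" and mem_cell: "x \<in> cell \<alpha> x"
proof -
  obtain U where "U \<in> \<P> \<alpha>" "x \<in> U"
    using partition[OF assms(1)] assms(2) unfolding partition_on_def by blast
  then show "cell \<alpha> x \<in> \<P> \<alpha>" "x \<in> cell \<alpha> x"
    using cell_unique[OF assms(1)] by auto
qed

lemma cells_subset_topspace: "\<alpha> \<in> Field omega1 \<Longrightarrow> U \<in> \<P> \<alpha> \<Longrightarrow> U \<subseteq> topspace X"
  by (meson openin_cells openin_subset)

lemma cell_subset_topspace:
  assumes "\<alpha> \<in> Field omega1" "x \<in> topspace X"
  shows "cell \<alpha> x \<subseteq> topspace X"
  by (rule cells_subset_topspace[OF assms(1) cell_in[OF assms]])

lemma cell_eq: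
  assumes "\<alpha> \<in> Field omega1" "x \<in> topspace X" "y \<in> cell \<alpha> x"
  shows "cell \<alpha> y = cell \<alpha> x"
  by (rule cell_unique[OF assms(1) cell_in[OF assms(1,2)] assms(3)])

lemma cell_mono:
  assumes "\<alpha> \<in> Field omega1" "\<beta> \<in> underS omega1 \<alpha>" "x \<in> topspace X"
  shows "cell \<alpha> x \<subseteq> cell \<beta> x"
proof -
  have "\<forall>\<alpha>\<in>Field omega1. \<forall>\<beta>\<in>underS omega1 \<alpha>. refines (topspace X) (\<P> \<alpha>) (\<P> \<beta>)"
    using matrix unfolding P_matrix_def by (elim conjE)
  then have "refines (topspace X) (\<P> \<alpha>) (\<P> \<beta>)"
    using assms(1,2) by blast
  then obtain V where V: "V \<in> \<P> \<beta>" "cell \<alpha> x \<subseteq> V"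
    using cell_in[OF assms(1,3)] unfolding refines_def by blast
  then show ?thesis
    using cell_unique[OF underS_omega1_Field[OF assms(2)] V(1)] mem_cell[OF assms(1,3)] by auto
qed

lemma cell_eq_below:
  assumes "\<alpha> \<in> Field omega1" "\<beta> \<in> underS omega1 \<alpha>" "x \<in> topspace X" "y \<in> topspace X"
    and "cell \<alpha> x = cell \<alpha> y"
  shows "cell \<beta> x = cell \<beta> y"
proof -
  have "y \<in> cell \<alpha> x"
    using mem_cell[OF assms(1,4)] assms(5) by simp
  then have "y \<in> cell \<beta> x"
    using cell_mono[OF assms(1-3)] by blast
  then show ?thesis
    using cell_eq[OF underS_omega1_Field[OF assms(2)] assms(3)] by simp
qed

lemma branch_successor:
  assumes "\<alpha> \<in> Field omega1" "x \<in> topspace X" "\<delta> \<in> underS omega1 \<alpha>"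
    and "\<And>\<beta>. \<beta> \<in> underS omega1 \<alpha> \<Longrightarrow> \<beta> = \<delta> \<or> \<beta> \<in> underS omega1 \<delta>"
  shows "branch \<alpha> x = cell \<delta> x"
proof -
  have \<delta>: "\<delta> \<in> Field omega1"
    using assms(3) by (rule underS_omega1_Field)
  have "cell \<delta> x \<subseteq> cell \<beta> x" if "\<beta> \<in> underS omega1 \<alpha>" for \<beta>
    using cell_mono[OF \<delta> _ assms(2)] assms(4)[OF that] by auto
  then show ?thesis
    using assms(3) cell_subset_topspace[OF \<delta> assms(2)] unfolding branch_def by auto
qed

text \<open>By condition (4) the cell is the intersection of all earlier matrix members containing
  it, and these are exactly the earlier cells of \<open>x\<close>. Hence a limit level needs no code
  value.\<close>

lemma cell_limit:
  assumes "limit_ordinal \<alpha>" "x \<in> topspace X"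
  shows "cell \<alpha> x = branch \<alpha> x"
proof -
  have \<alpha>: "\<alpha> \<in> Field omega1" using assms by (simp add: limit_ordinal_def)
  let ?S = "{V. \<exists>\<beta>\<in>underS omega1 \<alpha>. V \<in> \<P> \<beta> \<and> cell \<alpha> x \<subseteq> V}"
  have "\<forall>\<alpha>. limit_ordinal \<alpha> \<longrightarrow>
      (\<forall>U\<in>\<P> \<alpha>. U = \<Inter>{V. \<exists>\<beta>\<in>underS omega1 \<alpha>. V \<in> \<P> \<beta> \<and> U \<subseteq> V})"
    using matrix unfolding P_matrix_def by (elim conjE)
  then have "\<forall>U\<in>\<P> \<alpha>. U = \<Inter>{V. \<exists>\<beta>\<in>underS omega1 \<alpha>. V \<in> \<P> \<beta> \<and> U \<subseteq> V}"
    using assms(1) by (elim allE impE)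
  then have "cell \<alpha> x = \<Inter>?S"
    by (rule bspec) (rule cell_in[OF \<alpha> assms(2)])
  moreover have "?S = (\<lambda>\<beta>. cell \<beta> x) ` underS omega1 \<alpha>"
  proof
    show "?S \<subseteq> (\<lambda>\<beta>. cell \<beta> x) ` underS omega1 \<alpha>"
    proof safe
      fix V \<beta> assume V: "\<beta> \<in> underS omega1 \<alpha>" "V \<in> \<P> \<beta>" "cell \<alpha> x \<subseteq> V"
      then have "cell \<beta> x = V"
        using mem_cell[OF \<alpha> assms(2)] by (intro cell_unique underS_omega1_Field) auto
      then show "V \<in> (\<lambda>\<beta>. cell \<beta> x) ` underS omega1 \<alpha>"
        using V(1) by blast
    qed
    show "(\<lambda>\<beta>. cell \<beta> x) ` underS omega1 \<alpha> \<subseteq> ?S"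
    proof safe
      fix \<beta> assume \<beta>: "\<beta> \<in> underS omega1 \<alpha>"
      then show "\<exists>\<gamma>\<in>underS omega1 \<alpha>. cell \<beta> x \<in> \<P> \<gamma> \<and> cell \<alpha> x \<subseteq> cell \<beta> x"
        using cell_mono[OF \<alpha> \<beta> assms(2)] cell_in[OF underS_omega1_Field[OF \<beta>] assms(2)]
        by blast
    qed
  qed
  ultimately show ?thesis
    using cell_subset_topspace[OF \<alpha> assms(2)] unfolding branch_def by blast
qed

section \<open>Children of a branch and their numbering\<close>

lemma cell_in_children:
  assumes "\<alpha> \<in> Field omega1" "x \<in> topspace X"
  shows "cell \<alpha> x \<in> children \<alpha> (branch \<alpha> x)"
  using assms cell_in[OF assms] cell_mono[OF assms(1)] cell_subset_topspace[OF assms]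
  unfolding children_def branch_def by auto

text \<open>At the least ordinal the children form the whole partition, which has cardinality
  \<open>l\<close>. At a successor the branch is a cell of the preceding level, and the condition on
  members inside an earlier cell applies.\<close>

lemma card_children:
  assumes "\<alpha> \<in> Field omega1" "\<not> limit_ordinal \<alpha>" "x \<in> topspace X"
  shows "|children \<alpha> (branch \<alpha> x)| =o l"
  using assms(1,2)
proof (cases rule: nonlimit_cases)
  case 1
  then have "children \<alpha> (branch \<alpha> x) = \<P> \<alpha>"
    using cells_subset_topspace assms(1) by (auto simp: children_def branch_def)
  then show ?thesis using thin assms(1) by (simp add: thin_labeling_def)
next
  case (2 \<delta>)
  have "branch \<alpha> x = cell \<delta> x" "cell \<delta> x \<in> \<P> \<delta>"
    using branch_successor[OF assms(1,3) 2] cell_in[OF underS_omega1_Field[OF 2(1)] assms(3)]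
    by auto
  then show ?thesis using thin assms(1) 2 by (simp add: thin_labeling_def children_def)
qed

lemma numbering:
  assumes "\<alpha> \<in> Field omega1" "\<not> limit_ordinal \<alpha>" "x \<in> topspace X"
  shows bij_betw_numbering:
      "bij_betw (numbering \<alpha> (branch \<alpha> x)) (children \<alpha> (branch \<alpha> x)) (Field l)"
    and numbering_label:
      "\<And>U. U \<in> children \<alpha> (branch \<alpha> x) \<Longrightarrow> E (branch \<alpha> x) \<in> U \<Longrightarrow>
        numbering \<alpha> (branch \<alpha> x) U = z"
proof -
  let ?B = "branch \<alpha> x"
  have "\<exists>g. bij_betw g (children \<alpha> ?B) (Field l) \<and> (\<forall>U\<in>children \<alpha> ?B. E ?B \<in> U \<longrightarrow> g U = z)"
    using card_children[OF assms] Card_order z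
  proof (rule ex_bij_betw_prescribed)
    \<comment> \<open>Disjointness of the partition suffices here. At the least ordinal
      \<open>E ?B\<close> is the value of \<open>E\<close> at the whole space, which need not be a
      matrix member, so nothing about its location is assumed.\<close>
    fix U V assume "U \<in> children \<alpha> ?B" "V \<in> children \<alpha> ?B" "E ?B \<in> U" "E ?B \<in> V"
    then have "cell \<alpha> (E ?B) = U" "cell \<alpha> (E ?B) = V"
      by (auto simp: children_def intro!: cell_unique[OF assms(1)])
    then show "U = V" by simp
  qed
  from someI_ex[OF this, folded numbering_def]
  show "bij_betw (numbering \<alpha> ?B) (children \<alpha> ?B) (Field l)"
    and "\<And>U. U \<in> children \<alpha> ?B \<Longrightarrow> E ?B \<in> U \<Longrightarrow> numbering \<alpha> ?B U = z"
    by auto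
qed

section \<open>Codes of points: what they determine and why their support is finite\<close>

lemma code_in_Field:
  assumes "x \<in> topspace X"
  shows "code x \<alpha> \<in> Field l"
proof (cases "\<alpha> \<in> Field omega1 \<and> \<not> limit_ordinal \<alpha>")
  case True
  then have "numbering \<alpha> (branch \<alpha> x) (cell \<alpha> x) \<in> Field l"
    using cell_in_children assms by (intro bij_betw_apply[OF bij_betw_numbering]) auto
  then show ?thesis using True by (simp add: code_def)
qed (auto simp: code_def z)

text \<open>A cell at level \<open>\<alpha>\<close> determines all earlier cells, hence the branch
  and its numbering.\<close>

lemma code_cong:
  assumes "\<alpha> \<in> Field omega1" "x \<in> topspace X" "y \<in> topspace X" "cell \<alpha> x = cell \<alpha> y"
  shows "code x \<alpha> = code y \<alpha>"
proof -
  have "branch \<alpha> x = branch \<alpha> y"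
    using cell_eq_below[OF assms(1) _ assms(2,3,4)] by (simp add: branch_def)
  then show ?thesis using assms(4) by (simp add: code_def)
qed

text \<open>Transfinite induction: equal earlier cells give a common branch. At a limit the cell is
  the branch; otherwise the common numbering is injective on the children.\<close>

lemma cell_eq_of_code_eq:
  assumes "\<alpha> \<in> Field omega1" "x \<in> topspace X" "y \<in> topspace X" "code x \<alpha> = code y \<alpha>"
    and "\<And>\<beta>. \<beta> \<in> underS omega1 \<alpha> \<Longrightarrow> code x \<beta> = code y \<beta>"
  shows "cell \<alpha> x = cell \<alpha> y"
  using assms(1,4,5)
proof (induction \<alpha> rule: omega1_induct)
  case (1 \<alpha>)
  have "cell \<beta> x = cell \<beta> y" if \<beta>: "\<beta> \<in> underS omega1 \<alpha>" for \<beta>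
  proof (rule "1.IH"[OF \<beta> underS_omega1_Field[OF \<beta>]])
    show "code x \<beta> = code y \<beta>" using "1.prems"(3) \<beta> .
    show "code x \<gamma> = code y \<gamma>" if "\<gamma> \<in> underS omega1 \<beta>" for \<gamma>
      using "1.prems"(3) underS_omega1_trans[OF that \<beta>] .
  qed
  then have B: "branch \<alpha> x = branch \<alpha> y"
    by (simp add: branch_def)
  show ?case
  proof (cases "limit_ordinal \<alpha>")
    case True
    then show ?thesis using B cell_limit assms by simp
  next
    case False
    have "inj_on (numbering \<alpha> (branch \<alpha> x)) (children \<alpha> (branch \<alpha> x))"
      using bij_betw_numbering[OF "1.prems"(1) False assms(2)] by (rule bij_betw_imp_inj_on)
    moreover have "numbering \<alpha> (branch \<alpha> x) (cell \<alpha> x) = numbering \<alpha> (branch \<alpha> x) (cell \<alpha> y)"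
      using "1.prems"(1,2) False B by (simp add: code_def)
    moreover have "cell \<alpha> x \<in> children \<alpha> (branch \<alpha> x)" "cell \<alpha> y \<in> children \<alpha> (branch \<alpha> x)"
      using cell_in_children[OF "1.prems"(1)] assms(2,3) B by metis+
    ultimately show ?thesis
      by (rule inj_onD)
  qed
qed

text \<open>If the label of an earlier cell survives into the cell at a successor
  \<open>\<alpha>\<close>, the labeling condition makes it also the label of the parent cell, and
  the child containing the parent's label is numbered \<open>z\<close>. At limits the value is
  \<open>z\<close> by definition.\<close>

lemma code_trivial:
  assumes "\<alpha> \<in> Field omega1" "\<beta> \<in> underS omega1 \<alpha>" "x \<in> topspace X"
    and "E (cell \<beta> x) \<in> cell \<alpha> x"
  shows "code x \<alpha> = z"
proof (cases "limit_ordinal \<alpha>")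
  case False
  show ?thesis using assms(1) False
  proof (cases rule: nonlimit_cases)
    case (2 \<delta>)
    have \<delta>: "\<delta> \<in> Field omega1" and \<beta>: "\<beta> \<in> Field omega1"
      using 2 assms underS_omega1_Field by auto
    have "cell \<delta> x \<subseteq> cell \<beta> x"
      using cell_mono[OF \<delta> _ assms(3)] 2(2)[OF assms(2)] by auto
    moreover have "E (cell \<beta> x) \<in> cell \<delta> x"
      using cell_mono[OF assms(1) 2(1) assms(3)] assms(4) by blast
    ultimately have "E (cell \<delta> x) = E (cell \<beta> x)"
      by (rule label_eq[OF \<delta> cell_in[OF \<delta> assms(3)] \<beta> cell_in[OF \<beta> assms(3)]])
    then have "E (branch \<alpha> x) \<in> cell \<alpha> x"
      using branch_successor[OF assms(1,3) 2] assms(4) by simp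
    then show ?thesis
      using numbering_label[OF assms(1) False assms(3) cell_in_children[OF assms(1,3)]]
      by (simp add: code_def)
  qed (use assms in simp)
qed (simp add: code_def)

text \<open>Induction on \<open>\<alpha>\<close>. At a limit, thinness yields a
  \<open>\<delta>\<close> below \<open>\<alpha>\<close> whose cell has its label in all cells of
  \<open>x\<close> below \<open>\<alpha>\<close>, so \<open>code_trivial\<close> leaves no support
  strictly between \<open>\<delta>\<close> and \<open>\<alpha>\<close>.\<close>

lemma finite_support_below:
  assumes "x \<in> topspace X" "\<alpha> \<in> Field omega1"
  shows "finite {\<beta> \<in> underS omega1 \<alpha>. code x \<beta> \<noteq> z}"
  using assms(2)
proof (induction \<alpha> rule: omega1_induct)
  case (1 \<alpha>)
  \<comment> \<open>If the code is trivial strictly between \<open>\<delta>\<close> and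
    \<open>\<alpha>\<close>, the support below \<open>\<alpha>\<close> exceeds that below
    \<open>\<delta>\<close> by at most \<open>\<delta>\<close> itself, and the induction hypothesis
    applies.\<close>
  have bound: ?case
    if "\<delta> \<in> underS omega1 \<alpha>"
      "\<And>\<beta>. \<beta> \<in> underS omega1 \<alpha> \<Longrightarrow> \<delta> \<in> underS omega1 \<beta> \<Longrightarrow> code x \<beta> = z" for \<delta>
  proof (rule finite_subset)
    show "{\<beta> \<in> underS omega1 \<alpha>. code x \<beta> \<noteq> z} \<subseteq>
        insert \<delta> {\<beta> \<in> underS omega1 \<delta>. code x \<beta> \<noteq> z}"
      using that underS_omega1_total[OF underS_omega1_Field underS_omega1_Field[OF that(1)]]
      by blast
    show "finite (insert \<delta> {\<beta> \<in> underS omega1 \<delta>. code x \<beta> \<noteq> z})"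
      using "1.IH"[OF that(1) underS_omega1_Field[OF that(1)]] by simp
  qed
  show ?case
  proof (cases "limit_ordinal \<alpha>")
    case True
    \<comment> \<open>All cells of \<open>x\<close> below \<open>\<alpha>\<close> form a chain whose
      intersection contains \<open>x\<close>, as thinness requires.\<close>
    let ?L = "(\<lambda>\<beta>. cell \<beta> x) ` underS omega1 \<alpha>"
    have "?L \<subseteq> (\<Union>\<beta>\<in>underS omega1 \<alpha>. \<P> \<beta>)"
      using cell_in[OF underS_omega1_Field assms(1)] by blast
    moreover have "?L \<noteq> {}"
      using True by (auto simp: limit_ordinal_def)
    moreover have "chain_subset ?L"
      unfolding chain_subset_def ball_simps
    proof (intro ballI)
      fix \<beta> \<gamma> assume "\<beta> \<in> underS omega1 \<alpha>" "\<gamma> \<in> underS omega1 \<alpha>"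
      then have F: "\<beta> \<in> Field omega1" "\<gamma> \<in> Field omega1"
        by (auto intro: underS_omega1_Field)
      from underS_omega1_total[OF this]
      show "cell \<beta> x \<subseteq> cell \<gamma> x \<or> cell \<gamma> x \<subseteq> cell \<beta> x"
        using cell_mono[OF F(1) _ assms(1)] cell_mono[OF F(2) _ assms(1)] by auto
    qed
    moreover have "\<Inter>?L \<noteq> {}"
      using mem_cell[OF underS_omega1_Field assms(1)] by blast
    moreover have "\<forall>\<L>. \<L> \<subseteq> (\<Union>\<beta>\<in>underS omega1 \<alpha>. \<P> \<beta>) \<and> \<L> \<noteq> {} \<and>
        chain_subset \<L> \<and> \<Inter>\<L> \<noteq> {} \<longrightarrow> (\<exists>V\<in>\<L>. E V \<in> \<Inter>\<L>)"
      using thin "1.prems" by (simp add: thin_labeling_def)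
    ultimately have "\<exists>V\<in>?L. E V \<in> \<Inter>?L"
      by blast
    then obtain \<delta> where \<delta>: "\<delta> \<in> underS omega1 \<alpha>"
      "\<And>\<beta>. \<beta> \<in> underS omega1 \<alpha> \<Longrightarrow> E (cell \<delta> x) \<in> cell \<beta> x"
      by blast
    show ?thesis
      using \<delta>(1) code_trivial[OF underS_omega1_Field _ assms(1) \<delta>(2)] by (rule bound)
  next
    case False
    show ?thesis using 1(2) False
    proof (cases rule: nonlimit_cases)
      case (2 \<delta>)
      show ?thesis
      \<comment> \<open>Nothing lies strictly between \<open>\<alpha>\<close> and its predecessor
        \<open>\<delta>\<close>, so the second premise of \<open>bound\<close> holds
        vacuously.\<close>
      proof (rule bound[OF 2(1)])
        fix \<beta> assume \<beta>: "\<beta> \<in> underS omega1 \<alpha>" "\<delta> \<in> underS omega1 \<beta>"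
        have "\<delta> \<in> underS omega1 \<delta>"
          using 2(2)[OF \<beta>(1)] \<beta>(2) underS_omega1_trans by blast
        then show "code x \<beta> = z"
          by (simp add: underS_omega1_irrefl)
      qed
    qed simp
  qed
qed

text \<open>A point that is the label of its cell at level \<open>\<beta>\<close> lies in all its
  later cells, so this label survives at every level above \<open>\<beta>\<close>.\<close>

lemma code_trivial_above:
  assumes "\<beta> \<in> Field omega1" "y \<in> topspace X" "x = E (cell \<beta> y)"
    and "\<alpha> \<in> Field omega1" "\<beta> \<in> underS omega1 \<alpha>"
  shows "code x \<alpha> = z"
proof -
  have "x \<in> cell \<beta> y"
    using label_in[OF assms(1) cell_in[OF assms(1,2)]] assms(3) by simp
  then have x: "x \<in> topspace X" "cell \<beta> x = cell \<beta> y"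
    using cell_eq[OF assms(1,2)] cell_subset_topspace[OF assms(1,2)] by auto
  then have "E (cell \<beta> x) \<in> cell \<alpha> x"
    using mem_cell[OF assms(4) x(1)] assms(3) by simp
  then show ?thesis
    by (rule code_trivial[OF assms(4,5) x(1)])
qed

text \<open>Surjectivity of the labeling gives a level \<open>\<beta>\<close> at which
  \<open>x\<close> is the label of its own cell. Above \<open>\<beta>\<close> the code is trivial,
  and below it the support is finite.\<close>

lemma code_in_finite_codes:
  assumes "x \<in> topspace X"
  shows "code x \<in> finite_codes l z"
proof -
  have supp: "\<alpha> \<in> Field omega1 \<and> \<not> limit_ordinal \<alpha>" if "code x \<alpha> \<noteq> z" for \<alpha>
    using that by (simp add: code_def split: if_splits)
  obtain \<beta> V where \<beta>: "\<beta> \<in> Field omega1" "V \<in> \<P> \<beta>" "x = E V"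
    using ex_label[OF assms] by blast
  then have "x = E (cell \<beta> x)"
    using cell_unique[OF \<beta>(1,2)] label_in[OF \<beta>(1,2)] by simp
  note above = code_trivial_above[OF \<beta>(1) assms this]
  have "{\<alpha>. code x \<alpha> \<noteq> z} \<subseteq> insert \<beta> {\<alpha> \<in> underS omega1 \<beta>. code x \<alpha> \<noteq> z}"
    using above supp underS_omega1_total[OF \<beta>(1)] by blast
  then have "finite {\<alpha>. code x \<alpha> \<noteq> z}"
    by (rule finite_subset) (simp add: finite_support_below[OF assms \<beta>(1)])
  then show ?thesis
    using supp code_in_Field[OF assms] by (simp add: finite_codes_def)
qed

text \<open>The witness is the label of the child of the branch of \<open>y\<close> with number
  \<open>v\<close>. Staying inside that branch preserves the earlier values; being a label makes the
  later ones trivial.\<close>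

lemma code_modify:
  assumes "\<alpha> \<in> Field omega1" "\<not> limit_ordinal \<alpha>" "y \<in> topspace X" "v \<in> Field l"
  shows "\<exists>x\<in>topspace X. code x \<alpha> = v \<and> (\<forall>\<beta>\<in>underS omega1 \<alpha>. code x \<beta> = code y \<beta>) \<and>
    (\<forall>\<beta>\<in>Field omega1. \<alpha> \<in> underS omega1 \<beta> \<longrightarrow> code x \<beta> = z)"
proof -
  have "v \<in> numbering \<alpha> (branch \<alpha> y) ` children \<alpha> (branch \<alpha> y)"
    using bij_betw_imp_surj_on[OF bij_betw_numbering[OF assms(1-3)]] assms(4) by simp
  then obtain U where U: "U \<in> children \<alpha> (branch \<alpha> y)" "numbering \<alpha> (branch \<alpha> y) U = v"
    by auto
  have UP: "U \<in> \<P> \<alpha>" "U \<subseteq> branch \<alpha> y"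
    using U(1) by (auto simp: children_def)
  define x where "x = E U"
  have "x \<in> U"
    using label_in[OF assms(1) UP(1)] by (simp add: x_def)
  then have x: "x \<in> topspace X" and Ux: "cell \<alpha> x = U"
    using cell_unique[OF assms(1) UP(1)] cells_subset_topspace[OF assms(1) UP(1)] by auto
  have below: "cell \<beta> x = cell \<beta> y" if "\<beta> \<in> underS omega1 \<alpha>" for \<beta>
    using \<open>x \<in> U\<close> UP(2) that
    by (intro cell_eq[OF underS_omega1_Field assms(3)]) (auto simp: branch_def)
  then have "branch \<alpha> x = branch \<alpha> y"
    by (simp add: branch_def)
  then have "code x \<alpha> = v"
    using U Ux assms by (simp add: code_def)
  moreover have "code x \<beta> = code y \<beta>" if "\<beta> \<in> underS omega1 \<alpha>" for \<beta>
    using code_cong[OF underS_omega1_Field[OF that] x assms(3) below[OF that]] .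
  moreover have "code x \<beta> = z" if "\<beta> \<in> Field omega1" "\<alpha> \<in> underS omega1 \<beta>" for \<beta>
    by (rule code_trivial_above[OF assms(1) x _ that]) (simp add: x_def Ux[unfolded x_def])
  ultimately show ?thesis using x by blast
qed

section \<open>Every finitely supported code is the code of a point\<close>

lemma ex_point: "\<exists>x. x \<in> topspace X"
proof -
  obtain \<alpha> where \<alpha>: "\<alpha> \<in> Field omega1"
    using ex_omega1_least by blast
  then have "|\<P> \<alpha>| =o l"
    using thin by (simp add: thin_labeling_def)
  then have "|\<P> \<alpha>| =o |Field l|"
    using Card_order card_of_Field_ordIso ordIso_symmetric ordIso_transitive by blast
  then obtain g where "bij_betw g (\<P> \<alpha>) (Field l)"
    using card_of_ordIso by blast
  then obtain U where U: "U \<in> \<P> \<alpha>"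
    using z unfolding bij_betw_def by blast
  show ?thesis
    using label_in[OF \<alpha> U] cells_subset_topspace[OF \<alpha> U] by (intro exI[of _ "E U"]) auto
qed

text \<open>Induction on the size of the support: erase the value at its largest element, realise
  the remaining code by a point \<open>y\<close>, and restore the value with
  \<open>code_modify\<close>.\<close>

lemma code_surj:
  assumes "c \<in> finite_codes l z"
  shows "c \<in> code ` topspace X"
  using assms
proof (induction "card {\<alpha>. c \<alpha> \<noteq> z}" arbitrary: c rule: less_induct)
  case less
  let ?F = "{\<alpha>. c \<alpha> \<noteq> z}"
  have fin: "finite ?F" and F: "?F \<subseteq> Field omega1" "\<And>\<alpha>. \<alpha> \<in> ?F \<Longrightarrow> \<not> limit_ordinal \<alpha>"
    and cl: "\<And>\<alpha>. c \<alpha> \<in> Field l"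
    using less.prems by (auto simp: finite_codes_def)
  have outside: "code x \<beta> = c \<beta>" if "\<beta> \<notin> Field omega1" for x \<beta>
    using that F(1) by (auto simp: code_def)
  \<comment> \<open>Both cases supply a level \<open>\<alpha>\<close> to modify and a point already
    correct below it. For empty support the least ordinal and any point will do, as there is nothing
    below to match.\<close>
  have "\<exists>\<alpha>\<in>Field omega1. \<not> limit_ordinal \<alpha> \<and> (\<exists>y\<in>topspace X.
      (\<forall>\<beta>\<in>underS omega1 \<alpha>. code y \<beta> = c \<beta>) \<and>
      (\<forall>\<beta>. \<alpha> \<in> underS omega1 \<beta> \<longrightarrow> c \<beta> = z))"
  proof (cases "?F = {}")
    case True
    obtain \<alpha> where \<alpha>: "\<alpha> \<in> Field omega1" "underS omega1 \<alpha> = {}"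
      using ex_omega1_least by blast
    moreover obtain y where "y \<in> topspace X"
      by (rule exE[OF ex_point])
    moreover have "c \<beta> = z" for \<beta>
      using True by simp
    moreover have "\<not> limit_ordinal \<alpha>"
      using \<alpha>(2) by (simp add: limit_ordinal_def)
    ultimately show ?thesis
      by (intro bexI[of _ \<alpha>] conjI bexI[of _ y]) simp_all
  next
    case False
    from finite_omega1_has_max[OF fin this F(1)]
    obtain \<alpha> where \<alpha>: "\<alpha> \<in> ?F" "\<forall>\<beta>\<in>?F. \<beta> = \<alpha> \<or> \<beta> \<in> underS omega1 \<alpha>"
      by (elim bexE)
    let ?c = "c(\<alpha> := z)"
    have supp: "{\<beta>. ?c \<beta> \<noteq> z} = ?F - {\<alpha>}"
      by auto
    have "finite {\<beta>. ?c \<beta> \<noteq> z}"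
      unfolding supp using fin by (rule finite_Diff)
    moreover have "\<forall>\<beta>. ?c \<beta> \<in> Field l"
      using cl z by simp
    moreover have "\<forall>\<beta>. ?c \<beta> \<noteq> z \<longrightarrow> \<beta> \<in> Field omega1 \<and> \<not> limit_ordinal \<beta>"
      using F by auto
    ultimately have "?c \<in> finite_codes l z"
      unfolding finite_codes_def by (intro CollectI conjI)
    moreover have "card {\<beta>. ?c \<beta> \<noteq> z} < card ?F"
      unfolding supp using fin \<alpha>(1) by (rule card_Diff1_less)
    ultimately have "?c \<in> code ` topspace X"
      by (intro less.hyps)
    then obtain y where y: "y \<in> topspace X" "?c = code y"
      by (rule imageE)
    have "code y \<beta> = c \<beta>" if "\<beta> \<in> underS omega1 \<alpha>" for \<beta>
      using that underS_omega1_irrefl by (auto simp: y(2)[symmetric])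
    moreover have "c \<beta> = z" if "\<alpha> \<in> underS omega1 \<beta>" for \<beta>
    proof (rule ccontr)
      assume "c \<beta> \<noteq> z"
      then have "\<beta> = \<alpha> \<or> \<beta> \<in> underS omega1 \<alpha>"
        using \<alpha>(2) by simp
      then have "\<alpha> \<in> underS omega1 \<alpha>"
        using that underS_omega1_trans[OF that] by auto
      then show False
        by (simp add: underS_omega1_irrefl)
    qed
    moreover have "\<alpha> \<in> Field omega1" "\<not> limit_ordinal \<alpha>"
      using \<alpha>(1) F by auto
    ultimately show ?thesis
      using y(1) by (intro bexI[of _ \<alpha>] conjI bexI[of _ y]) simp_all
  qed
  then obtain \<alpha> y where \<alpha>: "\<alpha> \<in> Field omega1" "\<not> limit_ordinal \<alpha>" and y: "y \<in> topspace X"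
    "\<forall>\<beta>\<in>underS omega1 \<alpha>. code y \<beta> = c \<beta>" "\<And>\<beta>. \<alpha> \<in> underS omega1 \<beta> \<Longrightarrow> c \<beta> = z"
    by blast
  obtain x where x: "x \<in> topspace X" "code x \<alpha> = c \<alpha>"
    "\<forall>\<beta>\<in>underS omega1 \<alpha>. code x \<beta> = code y \<beta>"
    "\<forall>\<beta>\<in>Field omega1. \<alpha> \<in> underS omega1 \<beta> \<longrightarrow> code x \<beta> = z"
    using code_modify[OF \<alpha> y(1) cl] by blast
  have "code x \<beta> = c \<beta>" for \<beta>
  proof (cases "\<beta> \<in> Field omega1")
    case True
    from underS_omega1_total[OF \<alpha>(1) this] show ?thesis
      using x(2-4) y(2,3) True by auto
  qed (rule outside)
  then have "c = code x"
    by (simp add: fun_eq_iff)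
  then show ?case
    using x(1) by (rule image_eqI)
qed

section \<open>Cells as neighbourhoods: injectivity and continuity through codes\<close>

lemma base:
  assumes "openin X W" "x \<in> W"
  shows "\<exists>\<alpha>\<in>Field omega1. cell \<alpha> x \<subseteq> W"
proof -
  have "openin X = arbitrary union_of (\<lambda>U. U \<in> matrix_union \<P>)"
    using matrix unfolding P_matrix_def base_of_def by (elim conjE)
  then have "(arbitrary union_of (\<lambda>U. U \<in> matrix_union \<P>)) W"
    using assms(1) by simp
  then obtain \<alpha> V where V: "\<alpha> \<in> Field omega1" "V \<in> \<P> \<alpha>" "x \<in> V" "V \<subseteq> W"
    using assms(2) unfolding union_of_def matrix_union_def by blast
  then show ?thesis
    using cell_unique[OF V(1-3)] by blast
qed

text \<open>By \<open>t1\<close> and \<open>base\<close>, distinct points are separated by a cell of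
  one of them, whereas equal codes force equal cells at every level.\<close>

lemma inj_on_code: "inj_on code (topspace X)"
proof (rule inj_onI, rule ccontr)
  fix x y assume xy: "x \<in> topspace X" "y \<in> topspace X" "code x = code y" "x \<noteq> y"
  then obtain W where "openin X W" "x \<in> W" "y \<notin> W"
    using t1 unfolding t1_space_def by blast
  then obtain \<alpha> where \<alpha>: "\<alpha> \<in> Field omega1" "y \<notin> cell \<alpha> x"
    using base by blast
  have "cell \<alpha> x = cell \<alpha> y"
    using cell_eq_of_code_eq[OF \<alpha>(1) xy(1,2)] xy(3) by simp
  then show False
    using mem_cell[OF \<alpha>(1) xy(2)] \<alpha>(2) by simp
qed

end

text \<open>Points in one cell at level \<open>\<alpha>\<close> have equal codes up to
  \<open>\<alpha>\<close>, so their images have equal codes there and share a cell at level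
  \<open>\<alpha>\<close>. Thus \<open>f\<close> maps the cell of \<open>x\<close> into the cell of
  \<open>f x\<close>. Bijectivity is not assumed, so the lemma serves both directions of the
  homeomorphism.\<close>

lemma continuous_map_code_preserving:
  assumes "thinly_labeled l z X \<P> E" "thinly_labeled l z Y \<Q> F"
    and f: "\<And>x. x \<in> topspace X \<Longrightarrow> f x \<in> topspace Y"
    and code: "\<And>x. x \<in> topspace X \<Longrightarrow>
      thinly_labeled.code l z Y \<Q> F (f x) = thinly_labeled.code l z X \<P> E x"
  shows "continuous_map X Y f"
proof -
  interpret X: thinly_labeled l z X \<P> E by (rule assms(1))
  interpret Y: thinly_labeled l z Y \<Q> F by (rule assms(2))
  have "openin X {x \<in> topspace X. f x \<in> W}" if "openin Y W" for W
  proof (rule openin_subopen[THEN iffD2], intro ballI)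
    fix x assume "x \<in> {x \<in> topspace X. f x \<in> W}"
    then have x: "x \<in> topspace X" "f x \<in> W"
      by auto
    from Y.base[OF that x(2)]
    obtain \<alpha> where \<alpha>: "\<alpha> \<in> Field omega1" "Y.cell \<alpha> (f x) \<subseteq> W"
      by (elim bexE)
    have "f y \<in> W" if y: "y \<in> X.cell \<alpha> x" for y
    proof -
      have yX: "y \<in> topspace X"
        using y X.cell_subset_topspace[OF \<alpha>(1) x(1)] by blast
      have eq: "X.cell \<alpha> y = X.cell \<alpha> x"
        using X.cell_eq[OF \<alpha>(1) x(1) y] .
      have "Y.cell \<alpha> (f y) = Y.cell \<alpha> (f x)"
      proof (rule Y.cell_eq_of_code_eq[OF \<alpha>(1) f[OF yX] f[OF x(1)]])
        show "Y.code (f y) \<alpha> = Y.code (f x) \<alpha>"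
          using X.code_cong[OF \<alpha>(1) yX x(1) eq] code x(1) yX by simp
        fix \<beta> assume \<beta>: "\<beta> \<in> underS omega1 \<alpha>"
        show "Y.code (f y) \<beta> = Y.code (f x) \<beta>"
          using X.code_cong[OF underS_omega1_Field[OF \<beta>] yX x(1)
              X.cell_eq_below[OF \<alpha>(1) \<beta> yX x(1) eq]] code x(1) yX
          by simp
      qed
      then show ?thesis
        using Y.mem_cell[OF \<alpha>(1) f[OF yX]] \<alpha>(2) by blast
    qed
    then show "\<exists>T. openin X T \<and> x \<in> T \<and> T \<subseteq> {x \<in> topspace X. f x \<in> W}"
      using X.openin_cells[OF \<alpha>(1) X.cell_in[OF \<alpha>(1) x(1)]] X.mem_cell[OF \<alpha>(1) x(1)]
        X.cell_subset_topspace[OF \<alpha>(1) x(1)]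
      by (intro exI[of _ "X.cell \<alpha> x"]) blast
  qed
  then show ?thesis
    using f by (simp add: continuous_map_def)
qed

theorem theorem27:
  fixes l :: "'c rel" and X :: "'a topology" and Y :: "'b topology"
  assumes "Card_order l" and "infinite (Field l)"
    and "P_space X" and "P_space Y"
    and "has_thin_labeling l X" and "has_thin_labeling l Y"
  shows "X homeomorphic_space Y"
proof -
  obtain z where z: "z \<in> Field l"
    using assms(2) by fastforce
  obtain \<P> E \<Q> F where thin: "thin_labeling l X \<P> E" "thin_labeling l Y \<Q> F"
    using assms(5,6) by (auto simp: has_thin_labeling_def)
  interpret X: thinly_labeled l z X \<P> E
    using assms(1,3) z thin(1) by (simp add: thinly_labeled_def P_space_def)
  interpret Y: thinly_labeled l z Y \<Q> F
    using assms(1,4) z thin(2) by (simp add: thinly_labeled_def P_space_def)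
  \<comment> \<open>Both code maps are bijections onto \<open>finite_codes l z\<close>;
    \<open>f\<close> and \<open>g\<close> send a point to the point of the other space with the same
    code.\<close>
  define f where "f x = inv_into (topspace Y) Y.code (X.code x)" for x
  define g where "g y = inv_into (topspace X) X.code (Y.code y)" for y
  have f: "f x \<in> topspace Y" "Y.code (f x) = X.code x" if "x \<in> topspace X" for x
    using Y.code_surj[OF X.code_in_finite_codes[OF that]]
    by (simp_all add: f_def inv_into_into f_inv_into_f)
  have g: "g y \<in> topspace X" "X.code (g y) = Y.code y" if "y \<in> topspace Y" for y
    using X.code_surj[OF Y.code_in_finite_codes[OF that]]
    by (simp_all add: g_def inv_into_into f_inv_into_f)
  have "continuous_map X Y f"
    using continuous_map_code_preserving[OF X.thinly_labeled_axioms Y.thinly_labeled_axioms f] .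
  moreover have "continuous_map Y X g"
    using continuous_map_code_preserving[OF Y.thinly_labeled_axioms X.thinly_labeled_axioms g] .
  moreover have "g (f x) = x" if "x \<in> topspace X" for x
    using that f g by (intro inj_onD[OF X.inj_on_code]) simp_all
  moreover have "f (g y) = y" if "y \<in> topspace Y" for y
    using that f g by (intro inj_onD[OF Y.inj_on_code]) simp_all
  ultimately show ?thesis
    unfolding homeomorphic_space_def homeomorphic_maps_def by blast
qed

end
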